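(* Let $K$ be a field and let $\mathcal{F}=K[\alpha,\beta:\alpha^2=\beta^2=0]$. Every non-zero Laurent polynomial identity of $\mathcal{U}(\mathcal{F})$ has a support with at least four elements.
   Context: $\mathcal{U}(A)$ denotes the group of units of a $K$-algebra $A$ (associative with identity). $\mathcal{F}=K[\alpha,\beta:\alpha^2=\beta^2=0]$ is the quotient of the free associative $K$-algebra on two non-commuting variables $\alpha,\beta$ by the ideal generated by $\alpha^2$ and $\beta^2$. A Laurent polynomial over $K$ is an element of $K\langle X_1^{\pm1},X_2^{\pm1},\dots\rangle$, the group algebra over $K$ of the free group on the countably many generators $X_1,X_2,\dots$; its support is the set of elements of this free group having non-zero coefficient in it. A Laurent polynomial $f$ is a Laurent polynomial identity of $\mathcal{U}(A)$ if $f(u_1,u_2,\dots)=0$ for all $u_1,u_2,\dots\in\mathcal{U}(A)$. *)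

theory Defs
  imports Complex_Main "HOL-Library.Poly_Mapping"
begin

section \<open>Free monoids, written additively\<close>

text \<open>
  The convolution product on \<open>'m \<Rightarrow>\<^sub>0 'k\<close> from \<^theory>\<open>HOL-Library.Poly_Mapping\<close> expects the
  exponents to form an additively written, not necessarily commutative, monoid.  Hence
  concatenation of words is \<open>+\<close> and the empty word is \<open>0\<close>.
\<close>

datatype 'x word = Word (letters: "'x list")

instantiation word :: (type) monoid_add
begin

definition zero_word :: "'a word" where
  "0 = Word []"

definition plus_word :: "'a word \<Rightarrow> 'a word \<Rightarrow> 'a word" where
  "v + w = Word (letters v @ letters w)"

instance
  by standard (simp_all add: zero_word_def plus_word_def)

end

lemma add_word_eq_0_iff: "v + w = 0 \<longleftrightarrow> v = 0 \<and> w = (0 :: 'x word)"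
  by (cases v; cases w) (auto simp: zero_word_def plus_word_def)


section \<open>Free associative algebras and the algebra presented by \<open>\<alpha>\<^sup>2 = \<beta>\<^sup>2 = 0\<close>\<close>

type_synonym ('x, 'k) free_algebra = "'x word \<Rightarrow>\<^sub>0 'k"

definition fa_var :: "'x \<Rightarrow> ('x, 'k::field) free_algebra" where
  "fa_var x = Poly_Mapping.single (Word [x]) 1"

text \<open>The two-sided ideal generated by a set; closure under \<open>-\<close> follows from \<open>- a = (- 1) * a\<close>.\<close>

inductive_set two_sided_ideal_gen :: "'a::ring_1 set \<Rightarrow> 'a set" for S where
  zero: "0 \<in> two_sided_ideal_gen S"
| base: "s \<in> S \<Longrightarrow> s \<in> two_sided_ideal_gen S"
| add: "a \<in> two_sided_ideal_gen S \<Longrightarrow> b \<in> two_sided_ideal_gen S \<Longrightarrow> a + b \<in> two_sided_ideal_gen S"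
| mult_left: "a \<in> two_sided_ideal_gen S \<Longrightarrow> r * a \<in> two_sided_ideal_gen S"
| mult_right: "a \<in> two_sided_ideal_gen S \<Longrightarrow> a * r \<in> two_sided_ideal_gen S"

lemma two_sided_ideal_gen_uminus:
  "a \<in> two_sided_ideal_gen S \<Longrightarrow> - a \<in> two_sided_ideal_gen S"
  using two_sided_ideal_gen.mult_left[of a S "- 1"] by simp

lemma two_sided_ideal_gen_diff:
  "a \<in> two_sided_ideal_gen S \<Longrightarrow> b \<in> two_sided_ideal_gen S \<Longrightarrow> a - b \<in> two_sided_ideal_gen S"
  using two_sided_ideal_gen.add[of a S "- b"] two_sided_ideal_gen_uminus[of b S] by simp

datatype var = Alpha | Beta

definition sq_zero_ideal :: "(var, 'k::field) free_algebra set" where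
  "sq_zero_ideal = two_sided_ideal_gen {fa_var Alpha ^ 2, fa_var Beta ^ 2}"

lemma sq_zero_ideal_diff_self: "p - p \<in> sq_zero_ideal"
  by (simp add: sq_zero_ideal_def two_sided_ideal_gen.zero)

lemma sq_zero_ideal_mult_cong:
  assumes "p - p' \<in> sq_zero_ideal" "q - q' \<in> sq_zero_ideal"
  shows "p * q - p' * q' \<in> sq_zero_ideal"
proof -
  have "p * q - p' * q' = (p - p') * q + p' * (q - q')"
    by (simp add: algebra_simps)
  with assms show ?thesis
    unfolding sq_zero_ideal_def
    by (simp only: two_sided_ideal_gen.add two_sided_ideal_gen.mult_left two_sided_ideal_gen.mult_right)
qed

lemma lookup_0_mult:
  fixes p q :: "('x, 'k::field) free_algebra"
  shows "Poly_Mapping.lookup (p * q) 0 = Poly_Mapping.lookup p 0 * Poly_Mapping.lookup q 0"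
proof -
  have *: "(Poly_Mapping.lookup q w when v + w = 0) =
      ((Poly_Mapping.lookup q w when w = 0) when v = 0)" for v w :: "'x word"
    using add_word_eq_0_iff[of v w] by (auto simp: when_def)
  show ?thesis
    by (simp add: lookup_mult eq_commute[of 0] * Sum_any_when_independent mult_when)
qed

lemma one_notin_sq_zero_ideal: "1 \<notin> (sq_zero_ideal :: (var, 'k::field) free_algebra set)"
proof -
  have var0: "Poly_Mapping.lookup (fa_var x :: (var, 'k) free_algebra) 0 = 0" for x
    by (simp add: fa_var_def lookup_single zero_word_def)
  have "Poly_Mapping.lookup p 0 = 0" if "p \<in> sq_zero_ideal" for p :: "(var, 'k) free_algebra"
    using that unfolding sq_zero_ideal_def
    by induction (auto simp: lookup_add lookup_0_mult power2_eq_square var0)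
  then show ?thesis
    by (metis lookup_one_zero zero_neq_one)
qed

quotient_type (overloaded) 'k F_alg = "(var, 'k::field) free_algebra" /
  "\<lambda>p q. p - q \<in> sq_zero_ideal"
proof (rule equivpI)
  show "reflp (\<lambda>p q. p - q \<in> (sq_zero_ideal :: (var, 'k) free_algebra set))"
    by (rule reflpI) (simp add: sq_zero_ideal_def two_sided_ideal_gen.zero)
  show "symp (\<lambda>p q. p - q \<in> (sq_zero_ideal :: (var, 'k) free_algebra set))"
    by (rule sympI) (metis minus_diff_eq sq_zero_ideal_def two_sided_ideal_gen_uminus)
  show "transp (\<lambda>p q. p - q \<in> (sq_zero_ideal :: (var, 'k) free_algebra set))"
    unfolding sq_zero_ideal_def
  proof (rule transpI)
    fix p q r :: "(var, 'k) free_algebra"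
    assume "p - q \<in> two_sided_ideal_gen {fa_var Alpha ^ 2, fa_var Beta ^ 2}"
      "q - r \<in> two_sided_ideal_gen {fa_var Alpha ^ 2, fa_var Beta ^ 2}"
    from two_sided_ideal_gen.add[OF this]
    show "p - r \<in> two_sided_ideal_gen {fa_var Alpha ^ 2, fa_var Beta ^ 2}"
      by (simp only: diff_add_eq diff_add_cancel add_diff_eq add_diff_cancel_right')
  qed
qed

lemma diff_diff_cong: "(a - c) - (b - d) = (a - b) - (c - (d :: 'a::ab_group_add))"
  by (simp add: algebra_simps)

instantiation F_alg :: (field) ring_1
begin

lift_definition zero_F_alg :: "'a F_alg" is 0 .

lift_definition one_F_alg :: "'a F_alg" is 1 .

lift_definition plus_F_alg :: "'a F_alg \<Rightarrow> 'a F_alg \<Rightarrow> 'a F_alg" is "(+)"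
  unfolding sq_zero_ideal_def
  by (simp only: add_diff_add two_sided_ideal_gen.add)

lift_definition minus_F_alg :: "'a F_alg \<Rightarrow> 'a F_alg \<Rightarrow> 'a F_alg" is "(-)"
  unfolding sq_zero_ideal_def
  by (subst diff_diff_cong) (rule two_sided_ideal_gen_diff)

lift_definition uminus_F_alg :: "'a F_alg \<Rightarrow> 'a F_alg" is uminus
  unfolding sq_zero_ideal_def
  by (simp only: minus_diff_minus two_sided_ideal_gen_uminus)

lift_definition times_F_alg :: "'a F_alg \<Rightarrow> 'a F_alg \<Rightarrow> 'a F_alg" is "(*)"
  by (rule sq_zero_ideal_mult_cong)

instance
proof
  fix x y z :: "'a F_alg"
  note self = sq_zero_ideal_diff_self
  show "x + y + z = x + (y + z)" by transfer (simp only: add.assoc self)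
  show "x + y = y + x" by transfer (simp only: add.commute self)
  show "0 + x = x" by transfer (simp only: add_0 self)
  show "- x + x = 0" by transfer (simp only: left_minus self)
  show "x - y = x + - y" by transfer (simp only: add_uminus_conv_diff self)
  show "x * y * z = x * (y * z)" by transfer (simp only: mult.assoc self)
  show "1 * x = x" by transfer (simp only: mult_1 self)
  show "x * 1 = x" by transfer (simp only: mult_1_right self)
  show "(x + y) * z = x * z + y * z" by transfer (simp only: distrib_right self)
  show "x * (y + z) = x * y + x * z" by transfer (simp only: distrib_left self)
  show "(0 :: 'a F_alg) \<noteq> 1"
  proof (transfer, rule notI)
    assume "(0 :: (var, 'a) free_algebra) - 1 \<in> sq_zero_ideal"
    then have "- (0 - 1 :: (var, 'a) free_algebra) \<in> sq_zero_ideal"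
      unfolding sq_zero_ideal_def by (rule two_sided_ideal_gen_uminus)
    then have "(1 :: (var, 'a) free_algebra) \<in> sq_zero_ideal"
      by (simp only: minus_diff_eq diff_0_right)
    with one_notin_sq_zero_ideal show False
      by (rule notE)
  qed
qed

end

lift_definition scale_F :: "'k::field \<Rightarrow> 'k F_alg \<Rightarrow> 'k F_alg" is
  "\<lambda>c. Poly_Mapping.map ((*) c)"
  unfolding mult_map_scale_conv_mult sq_zero_ideal_def
  by (simp only: right_diff_distrib[symmetric] two_sided_ideal_gen.mult_left)


section \<open>\<open>K\<close>-algebras\<close>

locale K_algebra = vector_space scale
  for scale :: "'k::field \<Rightarrow> 'a::ring_1 \<Rightarrow> 'a" +
  assumes scale_mult_left: "scale c (x * y) = scale c x * y"
    and scale_mult_right: "scale c (x * y) = x * scale c y"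

lemma single_0_mult_commute:
  fixes p :: "('x, 'k::field) free_algebra"
  shows "Poly_Mapping.single 0 c * p = p * Poly_Mapping.single 0 c"
proof (rule poly_mapping_eqI)
  fix w
  have *: "(Poly_Mapping.lookup p v when w = v) = (Poly_Mapping.lookup p v when v = w)" for v
    by (auto simp: when_def)
  have "Poly_Mapping.lookup (p * Poly_Mapping.single 0 c) w = Poly_Mapping.lookup p w * c"
  proof -
    have "(\<Sum>q. (c when 0 = q) when w = v + q) = (c when w = v)" for v
    proof -
      have "((c when 0 = q) when w = v + q) = ((c when w = v) when q = 0)" for q
        by (auto simp: when_def)
      then show ?thesis by simp
    qed
    then show ?thesis
      by (simp add: lookup_mult lookup_single mult_when eq_commute[of w])
  qed
  moreover have "Poly_Mapping.lookup (Poly_Mapping.single 0 c * p) w = c * Poly_Mapping.lookup p w"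
    by (simp flip: mult_map_scale_conv_mult add: Poly_Mapping.map.rep_eq when_def)
  ultimately show "Poly_Mapping.lookup (Poly_Mapping.single 0 c * p) w =
      Poly_Mapping.lookup (p * Poly_Mapping.single 0 c) w"
    by simp
qed

lift_definition scalar_F :: "'k::field \<Rightarrow> 'k F_alg" is "Poly_Mapping.single 0" .

lemma scale_F_conv_mult: "scale_F c x = scalar_F c * x"
  by transfer (simp only: mult_map_scale_conv_mult sq_zero_ideal_diff_self)

lemma scalar_F_add: "scalar_F (a + b) = scalar_F a + scalar_F b"
  by transfer (simp only: single_add sq_zero_ideal_diff_self)

lemma scalar_F_mult: "scalar_F (a * b) = scalar_F a * scalar_F b"
proof transfer
  fix a b :: 'a
  have "Poly_Mapping.single (0 :: var word) (a * b) = Poly_Mapping.single 0 a * Poly_Mapping.single 0 b"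
    by (simp add: mult_single)
  then show "Poly_Mapping.single 0 (a * b) - Poly_Mapping.single 0 a * Poly_Mapping.single 0 b
      \<in> sq_zero_ideal"
    by (simp only: sq_zero_ideal_diff_self)
qed

lemma scalar_F_1: "scalar_F 1 = 1"
  by transfer (simp only: single_one sq_zero_ideal_diff_self)

lemma scalar_F_commute: "scalar_F c * x = x * scalar_F c"
  by transfer (simp only: single_0_mult_commute sq_zero_ideal_diff_self)

lemma K_algebra_scale_F: "K_algebra (scale_F :: 'k::field \<Rightarrow> 'k F_alg \<Rightarrow> 'k F_alg)"
proof unfold_locales
  fix a b :: 'k and x y :: "'k F_alg"
  show "scale_F a (x + y) = scale_F a x + scale_F a y"
    by (simp only: scale_F_conv_mult distrib_left)
  show "scale_F (a + b) x = scale_F a x + scale_F b x"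
    by (simp only: scale_F_conv_mult scalar_F_add distrib_right)
  show "scale_F a (scale_F b x) = scale_F (a * b) x"
    by (simp only: scale_F_conv_mult scalar_F_mult mult.assoc)
  show "scale_F 1 x = x"
    by (simp only: scale_F_conv_mult scalar_F_1 mult_1)
  show "scale_F a (x * y) = scale_F a x * y"
    by (simp only: scale_F_conv_mult mult.assoc)
  show "scale_F a (x * y) = x * scale_F a y"
    by (metis scale_F_conv_mult scalar_F_commute mult.assoc)
qed

interpretation F_alg: K_algebra scale_F
  by (rule K_algebra_scale_F)


section \<open>The group of units of a ring\<close>

typedef (overloaded) 'a units = "{u :: 'a::ring_1. \<exists>v. u * v = 1 \<and> v * u = 1}"
  morphisms unit_val Abs_unit
  by (rule exI[of _ 1]) auto

setup_lifting type_definition_units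

instantiation units :: (ring_1) "{monoid_mult, inverse}"
begin

lift_definition one_units :: "'a units" is 1
  by auto

lift_definition times_units :: "'a units \<Rightarrow> 'a units \<Rightarrow> 'a units" is "(*)"
proof -
  fix u u' :: 'a
  assume "\<exists>v. u * v = 1 \<and> v * u = 1" "\<exists>v. u' * v = 1 \<and> v * u' = 1"
  then obtain v v' where v: "u * v = 1" "v * u = 1" and v': "u' * v' = 1" "v' * u' = 1"
    by blast
  have "(u * u') * (v' * v) = u * (u' * v') * v" "(v' * v) * (u * u') = v' * (v * u) * u'"
    by (simp_all only: mult.assoc)
  then show "\<exists>w. (u * u') * w = 1 \<and> w * (u * u') = 1"
    using v v' by (intro exI[of _ "v' * v"]) simp
qed

lift_definition inverse_units :: "'a units \<Rightarrow> 'a units" is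
  "\<lambda>u. THE v. u * v = 1 \<and> v * u = 1"
proof -
  fix u :: 'a
  assume "\<exists>v. u * v = 1 \<and> v * u = 1"
  then have "\<exists>!v. u * v = 1 \<and> v * u = 1"
    by (metis mult.assoc mult_1 mult_1_right)
  from theI'[OF this]
  show "\<exists>w. (THE v. u * v = 1 \<and> v * u = 1) * w = 1 \<and> w * (THE v. u * v = 1 \<and> v * u = 1) = 1"
    by blast
qed

definition divide_units :: "'a units \<Rightarrow> 'a units \<Rightarrow> 'a units" where
  "divide_units u v = u * inverse v"

instance
  by standard (transfer; simp add: mult.assoc)+

end

lemma units_inverse:
  fixes u :: "'a::ring_1 units"
  shows "u * inverse u = 1" "inverse u * u = 1"
proof -
  have "u * inverse u = 1 \<and> inverse u * u = 1"
  proof transfer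
    fix u :: 'a
    assume "\<exists>v. u * v = 1 \<and> v * u = 1"
    then have "\<exists>!v. u * v = 1 \<and> v * u = 1"
      by (metis mult.assoc mult_1 mult_1_right)
    from theI'[OF this]
    show "u * (THE v. u * v = 1 \<and> v * u = 1) = 1 \<and> (THE v. u * v = 1 \<and> v * u = 1) * u = 1" .
  qed
  then show "u * inverse u = 1" "inverse u * u = 1"
    by auto
qed


section \<open>Free groups and Laurent polynomials\<close>

text \<open>
  The letter \<open>(x, True)\<close> stands for the generator \<open>x\<close> and \<open>(x, False)\<close> for its inverse.  The free
  group is the set of words in these letters modulo insertion and deletion of adjacent mutually
  inverse letters; as above it is written additively.
\<close>

inductive fg_cancel :: "('x \<times> bool) list \<Rightarrow> ('x \<times> bool) list \<Rightarrow> bool" where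
  "fg_cancel (xs @ (x, b) # (x, \<not> b) # ys) (xs @ ys)"

lemma fg_cancel_append:
  assumes "fg_cancel v w"
  shows "fg_cancel (us @ v) (us @ w)" and "fg_cancel (v @ us) (w @ us)"
proof -
  from assms obtain xs x b ys where "v = xs @ (x, b) # (x, \<not> b) # ys" "w = xs @ ys"
    by (auto elim: fg_cancel.cases)
  then show "fg_cancel (us @ v) (us @ w)" "fg_cancel (v @ us) (w @ us)"
    using fg_cancel.intros[of "us @ xs" x b ys] fg_cancel.intros[of xs x b "ys @ us"]
    by simp_all
qed

lemma equivclp_map:
  assumes "equivclp r v w" and "\<And>v w. r v w \<Longrightarrow> equivclp s (f v) (f w)"
  shows "equivclp s (f v) (f w)"
  using assms(1)
proof (induction rule: equivclp_induct)
  case base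
  show ?case by simp
next
  case (step y z)
  then show ?case
    using assms(2) by (meson equivclp_sym equivclp_trans)
qed

lemma equivclp_invariant:
  assumes "equivclp r v w" and "\<And>v w. r v w \<Longrightarrow> f v = f w"
  shows "f v = f w"
  using assms(1)
proof (induction rule: equivclp_induct)
  case base
  show ?case ..
next
  case (step y z)
  then show ?case
    using assms(2) by metis
qed

definition fg_inv :: "('x \<times> bool) list \<Rightarrow> ('x \<times> bool) list" where
  "fg_inv w = rev (map (\<lambda>(x, b). (x, \<not> b)) w)"

quotient_type 'x free_group = "('x \<times> bool) list" / "equivclp fg_cancel"
  by simp

lemma fg_inv_left: "equivclp fg_cancel (fg_inv w @ w) []"
proof (induction w)
  case Nil
  show ?case by (simp add: fg_inv_def)
next
  case (Cons l w)
  obtain x b where l: "l = (x, b)" by force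
  have "fg_cancel (fg_inv (l # w) @ l # w) (fg_inv w @ w)"
    using fg_cancel.intros[of "fg_inv w" x "\<not> b" w] by (simp add: l fg_inv_def)
  with Cons.IH show ?case
    by (meson equivclp_trans r_into_equivclp)
qed

instantiation free_group :: (type) group_add
begin

lift_definition zero_free_group :: "'a free_group" is "[]" .

lift_definition plus_free_group :: "'a free_group \<Rightarrow> 'a free_group \<Rightarrow> 'a free_group" is "(@)"
proof -
  fix v v' w w' :: "('a \<times> bool) list"
  assume "equivclp fg_cancel v v'" "equivclp fg_cancel w w'"
  then have "equivclp fg_cancel (v @ w) (v' @ w)" "equivclp fg_cancel (v' @ w) (v' @ w')"
    by (auto elim!: equivclp_map intro: fg_cancel_append)
  then show "equivclp fg_cancel (v @ w) (v' @ w')"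
    by (rule equivclp_trans)
qed

lift_definition uminus_free_group :: "'a free_group \<Rightarrow> 'a free_group" is fg_inv
proof (erule equivclp_map)
  fix v w :: "('a \<times> bool) list"
  assume "fg_cancel v w"
  then obtain xs x b ys where "v = xs @ (x, b) # (x, \<not> b) # ys" "w = xs @ ys"
    by (auto elim: fg_cancel.cases)
  then have "fg_cancel (fg_inv v) (fg_inv w)"
    using fg_cancel.intros[of "fg_inv ys" x b "fg_inv xs"] by (simp add: fg_inv_def)
  then show "equivclp fg_cancel (fg_inv v) (fg_inv w)"
    by blast
qed

definition minus_free_group :: "'a free_group \<Rightarrow> 'a free_group \<Rightarrow> 'a free_group" where
  "minus_free_group g h = g + - h"

instance
proof
  fix g h :: "'a free_group"
  show "- g + g = 0"
    by transfer (rule fg_inv_left)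
  show "g + - h = g - h"
    by (simp add: minus_free_group_def)
qed (transfer; simp)+

end

definition word_eval :: "('x \<Rightarrow> 'a::ring_1 units) \<Rightarrow> ('x \<times> bool) list \<Rightarrow> 'a units" where
  "word_eval u w = prod_list (map (\<lambda>(x, b). if b then u x else inverse (u x)) w)"

lemma word_eval_append: "word_eval u (v @ w) = word_eval u v * word_eval u w"
  by (simp add: word_eval_def)

lemma word_eval_cancel:
  assumes "fg_cancel v w"
  shows "word_eval u v = word_eval u w"
proof -
  from assms obtain xs x b ys where vw: "v = xs @ [(x, b), (x, \<not> b)] @ ys" "w = xs @ ys"
    by (auto elim: fg_cancel.cases)
  have "word_eval u [(x, b), (x, \<not> b)] = 1"
    by (simp add: word_eval_def units_inverse)
  then show ?thesis
    by (simp only: vw word_eval_append mult_1)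
qed

text \<open>
  The homomorphism from the free group to the units of a ring sending each generator \<open>x\<close> to
  \<open>u x\<close>; the choice of the representing word is irrelevant by \<open>fg_eval_abs_free_group\<close>.
\<close>

definition fg_eval :: "('x \<Rightarrow> 'a::ring_1 units) \<Rightarrow> 'x free_group \<Rightarrow> 'a units" where
  "fg_eval u g = word_eval u (rep_free_group g)"

lemma fg_eval_abs_free_group: "fg_eval u (abs_free_group w) = word_eval u w"
proof -
  have "equivclp fg_cancel (rep_free_group (abs_free_group w)) w"
    by (rule Quotient3_rep_abs[OF Quotient3_free_group]) simp
  then show ?thesis
    unfolding fg_eval_def using word_eval_cancel by (rule equivclp_invariant)
qed

lemma fg_eval_add: "fg_eval u (g + h) = fg_eval u g * fg_eval u h"
proof -
  obtain v w where "g = abs_free_group v" "h = abs_free_group w"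
    by (metis Quotient3_abs_rep[OF Quotient3_free_group])
  then show ?thesis
    by (simp add: plus_free_group.abs_eq fg_eval_abs_free_group word_eval_append)
qed

text \<open>
  The group algebra of the free group on countably many generators, with the library's convolution
  product.  The generators are indexed from \<open>0\<close>, and the support of \<open>f\<close> is \<open>Poly_Mapping.keys f\<close>.
\<close>

type_synonym 'k laurent = "nat free_group \<Rightarrow>\<^sub>0 'k"

definition laurent_eval ::
    "('k::field \<Rightarrow> 'a::ring_1 \<Rightarrow> 'a) \<Rightarrow> (nat \<Rightarrow> 'a units) \<Rightarrow> 'k laurent \<Rightarrow> 'a" where
  "laurent_eval scale u f =
     (\<Sum>g\<in>Poly_Mapping.keys f. scale (Poly_Mapping.lookup f g) (unit_val (fg_eval u g)))"

text \<open>The argument \<open>scale\<close> is the scalar multiplication of the \<open>K\<close>-algebra \<open>'a\<close>.\<close>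

definition laurent_identity :: "('k::field \<Rightarrow> 'a::ring_1 \<Rightarrow> 'a) \<Rightarrow> 'k laurent \<Rightarrow> bool" where
  "laurent_identity scale f \<longleftrightarrow> (\<forall>u. laurent_eval scale u f = 0)"

end

(* Send alpha to e_12 and beta to t e_21 in the 2 x 2 matrices over K[t]. Some units of F then become
   the matrices E_12(p) E_21(p) with p = t^(i+1), which play ping-pong on pairs of polynomials, so
   that applying a reduced word to (1, 1) makes the degree grow with every letter. A matrix M of
   determinant 1 and trace 2 satisfies M^2 = 2 M - 1, which forbids this growth for a cyclically
   reduced word; so only the trivial word has trace 2. An identity with at most three terms has
   coefficient sum 0, by substituting 1, and a relation a + b M + c N = 0 with a + b + c = 0 between
   matrices of determinant 1 forces M to have trace 2, by comparing the determinants of a + b M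
   and - c N. *)

theory Submission
  imports Defs "HOL-Computational_Algebra.Polynomial"
begin

section \<open>Two by two matrices\<close>

datatype 'a mat2 = Mat2 'a 'a 'a 'a

instantiation mat2 :: (comm_ring_1) ring_1
begin

definition zero_mat2 :: "'a mat2" where
  "0 = Mat2 0 0 0 0"

definition one_mat2 :: "'a mat2" where
  "1 = Mat2 1 0 0 1"

fun plus_mat2 :: "'a mat2 \<Rightarrow> 'a mat2 \<Rightarrow> 'a mat2" where
  "Mat2 a b c d + Mat2 a' b' c' d' = Mat2 (a + a') (b + b') (c + c') (d + d')"

fun minus_mat2 :: "'a mat2 \<Rightarrow> 'a mat2 \<Rightarrow> 'a mat2" where
  "Mat2 a b c d - Mat2 a' b' c' d' = Mat2 (a - a') (b - b') (c - c') (d - d')"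

fun uminus_mat2 :: "'a mat2 \<Rightarrow> 'a mat2" where
  "- Mat2 a b c d = Mat2 (- a) (- b) (- c) (- d)"

fun times_mat2 :: "'a mat2 \<Rightarrow> 'a mat2 \<Rightarrow> 'a mat2" where
  "Mat2 a b c d * Mat2 a' b' c' d' =
     Mat2 (a * a' + b * c') (a * b' + b * d') (c * a' + d * c') (c * b' + d * d')"

instance
proof
  fix x y z :: "'a mat2"
  show "x + y + z = x + (y + z)" by (cases x; cases y; cases z) (simp add: add.assoc)
  show "x + y = y + x" by (cases x; cases y) (simp add: add.commute)
  show "0 + x = x" by (cases x) (simp add: zero_mat2_def)
  show "- x + x = 0" by (cases x) (simp add: zero_mat2_def)
  show "x - y = x + - y" by (cases x; cases y) simp
  show "x * y * z = x * (y * z)" by (cases x; cases y; cases z) (simp add: algebra_simps)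
  show "1 * x = x" by (cases x) (simp add: one_mat2_def)
  show "x * 1 = x" by (cases x) (simp add: one_mat2_def)
  show "(x + y) * z = x * z + y * z" by (cases x; cases y; cases z) (simp add: algebra_simps)
  show "x * (y + z) = x * y + x * z" by (cases x; cases y; cases z) (simp add: algebra_simps)
  show "(0 :: 'a mat2) \<noteq> 1" by (simp add: zero_mat2_def one_mat2_def)
qed

end

fun trace2 :: "'a::comm_ring_1 mat2 \<Rightarrow> 'a" where
  "trace2 (Mat2 a b c d) = a + d"

fun det2 :: "'a::comm_ring_1 mat2 \<Rightarrow> 'a" where
  "det2 (Mat2 a b c d) = a * d - b * c"

fun act2 :: "'a::comm_ring_1 mat2 \<Rightarrow> 'a \<times> 'a \<Rightarrow> 'a \<times> 'a" where
  "act2 (Mat2 a b c d) (x, y) = (a * x + b * y, c * x + d * y)"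

lemma trace2_mult_commute: "trace2 (m * n) = trace2 (n * m)"
  by (cases m; cases n) (simp add: algebra_simps)

lemma det2_mult: "det2 (m * n) = det2 m * det2 n"
  by (cases m; cases n) (simp add: algebra_simps)

lemma det2_one: "det2 1 = 1"
  by (simp add: one_mat2_def)

lemma trace2_one: "trace2 1 = 2"
  by (simp add: one_mat2_def)

lemma act2_mult: "act2 (m * n) v = act2 m (act2 n v)"
  by (cases m; cases n; cases v) (simp add: algebra_simps)

lemma act2_one: "act2 1 v = v"
  by (cases v) (simp add: one_mat2_def)

text \<open>Cayley-Hamilton for trace 2 and determinant 1, applied to a vector.\<close>

lemma act2_square_unipotent:
  assumes "det2 m = 1" "trace2 m = 2" "act2 m (x, y) = (x', y')"
  shows "act2 m (x', y') = (2 * x' - x, 2 * y' - y)"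
proof (cases m)
  case (Mat2 a b c d)
  from assms(2) have d: "d = 2 - a"
    by (simp add: Mat2 eq_diff_eq add.commute)
  from assms(1) have det: "a * (2 - a) - b * c = 1"
    by (simp only: Mat2 det2.simps d)
  have "b * c = a * (2 - a) - (a * (2 - a) - b * c)"
    by simp
  then have bc: "b * c = a * (2 - a) - 1"
    by (simp only: det)
  have xy: "x' = a * x + b * y" "y' = c * x + (2 - a) * y"
    using assms(3) by (simp_all add: Mat2 d)
  have "a * x' + b * y' = a * a * x + b * y * 2 + (b * c) * x"
    unfolding xy by (simp add: algebra_simps)
  moreover have "c * x' + d * y' = (b * c) * y + c * x * 2 + (2 - a) * (2 - a) * y"
    unfolding xy d by (simp add: algebra_simps)
  ultimately show ?thesis
    unfolding bc by (simp add: Mat2 xy algebra_simps)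
qed

definition scalar2 :: "'k::field \<Rightarrow> 'k poly mat2" where
  "scalar2 c = Mat2 [:c:] 0 0 [:c:]"


section \<open>Evaluation of the free algebra\<close>

text \<open>A field mapped into the centre of a ring: the setting in which evaluating non-commuting
  variables is multiplicative.\<close>

locale central_hom =
  fixes s :: "'k::field \<Rightarrow> 'r::ring_1"
  assumes s_add: "s (a + b) = s a + s b"
    and s_mult: "s (a * b) = s a * s b"
    and s_one: "s 1 = 1"
    and s_commute: "s a * r = r * s a"
begin

lemma s_zero: "s 0 = 0"
  using s_add[of 0 0] by simp

definition fa_eval :: "('x \<Rightarrow> 'r) \<Rightarrow> ('x, 'k) free_algebra \<Rightarrow> 'r" where
  "fa_eval h p = (\<Sum>w\<in>Poly_Mapping.keys p. s (Poly_Mapping.lookup p w) * prod_list (map h (letters w)))"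

text \<open>Cancellation can make the keys of a sum smaller than the union, so additivity needs a
  common index set; the extra terms vanish because \<open>s 0 = 0\<close>.\<close>

lemma fa_eval_superset:
  assumes "finite W" "Poly_Mapping.keys p \<subseteq> W"
  shows "fa_eval h p = (\<Sum>w\<in>W. s (Poly_Mapping.lookup p w) * prod_list (map h (letters w)))"
  unfolding fa_eval_def
  by (rule sum.mono_neutral_left) (use assms in \<open>auto simp: s_zero in_keys_iff\<close>)

lemma fa_eval_zero: "fa_eval h 0 = 0"
  by (simp add: fa_eval_def)

lemma fa_eval_add: "fa_eval h (p + q) = fa_eval h p + fa_eval h q"
proof -
  let ?W = "Poly_Mapping.keys p \<union> Poly_Mapping.keys q"
  have "Poly_Mapping.keys (p + q) \<subseteq> ?W" by (rule Poly_Mapping.keys_add)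
  then show ?thesis
    by (simp add: fa_eval_superset[of ?W] lookup_add s_add distrib_right sum.distrib)
qed

lemma fa_eval_diff: "fa_eval h (p - q) = fa_eval h p - fa_eval h q"
  using fa_eval_add[of h "p - q" q] by simp

lemma fa_eval_sum: "fa_eval h (\<Sum>i\<in>I. p i) = (\<Sum>i\<in>I. fa_eval h (p i))"
  by (induction I rule: infinite_finite_induct) (simp_all add: fa_eval_zero fa_eval_add)

lemma fa_eval_single:
  "fa_eval h (Poly_Mapping.single w c) = s c * prod_list (map h (letters w))"
  by (simp add: fa_eval_def s_zero)

lemma fa_eval_one: "fa_eval h 1 = 1"
  using fa_eval_single[of h 0 1] by (simp add: zero_word_def s_one flip: single_one)

lemma poly_mapping_sum_singles:
  fixes p :: "('x, 'k) free_algebra"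
  shows "p = (\<Sum>w\<in>Poly_Mapping.keys p. Poly_Mapping.single w (Poly_Mapping.lookup p w))"
  by (rule poly_mapping_eqI) (simp add: lookup_sum lookup_single when_def in_keys_iff)

text \<open>Bilinearity reduces this to single words, where centrality moves the second coefficient
  past the first word.\<close>

lemma fa_eval_mult: "fa_eval h (p * q) = fa_eval h p * fa_eval h q"
proof -
  have single: "fa_eval h (Poly_Mapping.single v c * Poly_Mapping.single w d) =
      fa_eval h (Poly_Mapping.single v c) * fa_eval h (Poly_Mapping.single w d)" for v w c d
  proof -
    let ?h = "\<lambda>w. prod_list (map h (letters w))"
    have "s c * ?h v * (s d * ?h w) = s c * (?h v * s d) * ?h w" by (simp only: mult.assoc)
    also have "\<dots> = s c * s d * (?h v * ?h w)" by (simp only: s_commute[of d "?h v", symmetric] mult.assoc)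
    finally show ?thesis
      by (simp add: mult_single fa_eval_single plus_word_def s_mult)
  qed
  \<comment> \<open>The expansions are part of the statement itself: rewriting \<open>p\<close>
    would also hit the \<open>p\<close> inside its own expansion.\<close>
  have "fa_eval h ((\<Sum>v\<in>Poly_Mapping.keys p. Poly_Mapping.single v (Poly_Mapping.lookup p v)) *
      (\<Sum>w\<in>Poly_Mapping.keys q. Poly_Mapping.single w (Poly_Mapping.lookup q w))) =
      fa_eval h (\<Sum>v\<in>Poly_Mapping.keys p. Poly_Mapping.single v (Poly_Mapping.lookup p v)) *
      fa_eval h (\<Sum>w\<in>Poly_Mapping.keys q. Poly_Mapping.single w (Poly_Mapping.lookup q w))"
    by (simp only: sum_product fa_eval_sum single)
  then show ?thesis
    by (simp only: poly_mapping_sum_singles[symmetric])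
qed

end

interpretation scalar2: central_hom "scalar2 :: 'k::field \<Rightarrow> 'k poly mat2"
proof
  fix a b :: 'k and r :: "'k poly mat2"
  show "scalar2 (a + b) = scalar2 a + scalar2 b"
    by (simp add: scalar2_def)
  show "scalar2 (a * b) = scalar2 a * scalar2 b"
    by (simp add: scalar2_def)
  show "scalar2 (1 :: 'k) = 1"
    by (simp add: scalar2_def one_mat2_def one_pCons)
  show "scalar2 a * r = r * scalar2 a"
    by (cases r) (simp add: scalar2_def mult.commute)
qed

section \<open>Representation of \<open>F_alg\<close> by matrices over K[t]\<close>

fun var_mat :: "var \<Rightarrow> 'k::field poly mat2" where
  "var_mat Alpha = Mat2 0 1 0 0"
| "var_mat Beta = Mat2 0 0 (monom 1 1) 0"

text \<open>Both variables go to strictly triangular matrices, which square to zero; this makes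
  \<open>F_mat\<close> well defined on the quotient.\<close>

lemma fa_eval_sq_zero_ideal:
  assumes "p \<in> (sq_zero_ideal :: (var, 'k::field) free_algebra set)"
  shows "scalar2.fa_eval var_mat p = 0"
proof -
  have sq: "scalar2.fa_eval var_mat (fa_var x ^ 2 :: (var, 'k) free_algebra) = 0" for x
    by (cases x) (simp_all add: power2_eq_square fa_var_def scalar2.fa_eval_mult
        scalar2.fa_eval_single scalar2.s_one zero_mat2_def)
  show ?thesis
    using assms unfolding sq_zero_ideal_def
    by induction (auto simp: sq scalar2.fa_eval_zero scalar2.fa_eval_add scalar2.fa_eval_mult)
qed

lift_definition F_mat :: "'k::field F_alg \<Rightarrow> 'k poly mat2" is "scalar2.fa_eval var_mat"
  using fa_eval_sq_zero_ideal scalar2.fa_eval_diff by (metis eq_iff_diff_eq_0)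

lift_definition F_var :: "var \<Rightarrow> 'k::field F_alg" is fa_var .

lemma F_mat_zero: "F_mat 0 = 0"
  by transfer (rule scalar2.fa_eval_zero)

lemma F_mat_one: "F_mat 1 = 1"
  by transfer (rule scalar2.fa_eval_one)

lemma F_mat_add: "F_mat (x + y) = F_mat x + F_mat y"
  by transfer (rule scalar2.fa_eval_add)

lemma F_mat_mult: "F_mat (x * y) = F_mat x * F_mat y"
  by transfer (rule scalar2.fa_eval_mult)

lemma F_mat_scale: "F_mat (scale_F c x) = scalar2 c * F_mat x"
proof -
  have "F_mat (scalar_F c) = scalar2 c"
    by transfer (simp add: scalar2.fa_eval_single zero_word_def)
  then show ?thesis
    by (simp add: scale_F_conv_mult F_mat_mult)
qed

lemma F_mat_sum: "F_mat (\<Sum>i\<in>I. x i) = (\<Sum>i\<in>I. F_mat (x i))"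
  by (induction I rule: infinite_finite_induct) (simp_all add: F_mat_zero F_mat_add)

lemma F_mat_var: "F_mat (F_var x) = var_mat x"
  by transfer (simp add: fa_var_def scalar2.fa_eval_single scalar2.s_one)

lemma F_var_square: "F_var x * F_var x = 0"
proof transfer
  fix x
  have "fa_var x ^ 2 \<in> (sq_zero_ideal :: (var, 'a) free_algebra set)"
    unfolding sq_zero_ideal_def by (cases x) (auto intro: two_sided_ideal_gen.base)
  then show "fa_var x * fa_var x - 0 \<in> (sq_zero_ideal :: (var, 'a) free_algebra set)"
    by (simp only: power2_eq_square diff_0_right)
qed


section \<open>A free group of units\<close>

text \<open>If \<open>x * x = 0\<close> then \<open>1 - x\<close> inverts \<open>1 + x\<close>; the
  value 1 elsewhere keeps the map total.\<close>

lift_definition unip_unit :: "'a::ring_1 \<Rightarrow> 'a units" is "\<lambda>x. if x * x = 0 then 1 + x else 1"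
proof -
  fix x :: 'a
  show "\<exists>v. (if x * x = 0 then 1 + x else 1) * v = 1 \<and> v * (if x * x = 0 then 1 + x else 1) = 1"
    by (cases "x * x = 0") (auto intro!: exI[of _ "1 - x"] simp: algebra_simps)
qed

text \<open>The alternating word x y x ... y x of length 2n + 1; it begins and ends in x, hence
  squares to zero.\<close>

definition F_alt :: "var \<Rightarrow> var \<Rightarrow> nat \<Rightarrow> 'k::field F_alg" where
  "F_alt x y n = F_var x * (F_var y * F_var x) ^ n"

lemma F_alt_square: "F_alt x y n * F_alt x y n = (0 :: 'k::field F_alg)"
proof -
  have "F_alt x y n * F_var x = (0 :: 'k F_alg)"
  proof (cases n)
    case 0
    then show ?thesis by (simp add: F_alt_def F_var_square)
  next
    case (Suc m)
    have "(F_alt x y n * F_var x :: 'k F_alg) = F_var x * (F_var y * F_var x) ^ m * F_var y * (F_var x * F_var x)"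
      by (simp only: F_alt_def Suc power_Suc2 mult.assoc)
    then show ?thesis by (simp add: F_var_square)
  qed
  then have "F_alt x y n * F_var x * (F_var y * F_var x) ^ n = (0 :: 'k F_alg)"
    by (simp only: mult_zero_left)
  then show ?thesis
    by (simp only: F_alt_def mult.assoc)
qed

text \<open>The exponents \<open>Suc i\<close> and \<open>i\<close> differ because the image of Beta
  carries a factor t and that of Alpha none: both shears get the parameter t^(i+1).\<close>

definition gen_unit :: "nat \<Rightarrow> 'k::field F_alg units" where
  "gen_unit i = unip_unit (F_alt Alpha Beta (Suc i)) * unip_unit (F_alt Beta Alpha i)"

definition unit_mat :: "'k::field F_alg units \<Rightarrow> 'k poly mat2" where
  "unit_mat u = F_mat (unit_val u)"

lemma unit_mat_mult: "unit_mat (u * v) = unit_mat u * unit_mat v"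
  by (simp add: unit_mat_def times_units.rep_eq F_mat_mult)

lemma unit_mat_one: "unit_mat 1 = 1"
  by (simp add: unit_mat_def one_units.rep_eq F_mat_one)

lemma F_mat_alt_Alpha: "F_mat (F_alt Alpha Beta n) = Mat2 0 (monom 1 n) 0 0"
proof (induction n)
  case 0
  show ?case by (simp add: F_alt_def F_mat_var)
next
  case (Suc n)
  have "(F_alt Alpha Beta (Suc n) :: 'a F_alg) = F_alt Alpha Beta n * (F_var Beta * F_var Alpha)"
    by (simp only: F_alt_def power_Suc2 mult.assoc)
  with Suc show ?case by (simp add: F_mat_mult F_mat_var mult_monom)
qed

lemma F_mat_alt_Beta: "F_mat (F_alt Beta Alpha n) = Mat2 0 0 (monom 1 (Suc n)) 0"
proof (induction n)
  case 0
  show ?case by (simp add: F_alt_def F_mat_var)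
next
  case (Suc n)
  have "(F_alt Beta Alpha (Suc n) :: 'a F_alg) = F_alt Beta Alpha n * (F_var Alpha * F_var Beta)"
    by (simp only: F_alt_def power_Suc2 mult.assoc)
  with Suc show ?case by (simp add: F_mat_mult F_mat_var mult_monom)
qed

section \<open>Shear matrices and ping-pong on pairs of polynomials\<close>

definition shear_poly :: "nat \<Rightarrow> 'k::field poly" where
  "shear_poly i = monom 1 (Suc i)"

text \<open>With p = \<open>shear_poly i\<close>, these are E_12(p) E_21(p) and its inverse E_21(-p)
  E_12(-p).\<close>

fun letter_mat :: "nat \<times> bool \<Rightarrow> 'k::field poly mat2" where
  "letter_mat (i, True) = Mat2 (1 + shear_poly i * shear_poly i) (shear_poly i) (shear_poly i) 1"
| "letter_mat (i, False) = Mat2 1 (- shear_poly i) (- shear_poly i) (1 + shear_poly i * shear_poly i)"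

lemma letter_mat_cancel: "letter_mat (i, b) * letter_mat (i, \<not> b) = 1"
  by (cases b) (simp_all add: one_mat2_def algebra_simps)

lemma det2_letter_mat: "det2 (letter_mat l) = 1"
  by (cases l rule: letter_mat.cases) (simp_all add: algebra_simps)

lemma unit_mat_gen_unit: "unit_mat (gen_unit i) = letter_mat (i, True)"
  by (simp add: unit_mat_def gen_unit_def times_units.rep_eq unip_unit.rep_eq F_alt_square
      F_mat_mult F_mat_add F_mat_one F_mat_alt_Alpha F_mat_alt_Beta one_mat2_def shear_poly_def)

lemma unit_mat_inverse_gen_unit: "unit_mat (inverse (gen_unit i)) = (letter_mat (i, False) :: 'k::field poly mat2)"
proof -
  let ?m = "unit_mat (inverse (gen_unit i)) :: 'k poly mat2"
  have "?m * letter_mat (i, True) = 1"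
    by (simp only: unit_mat_gen_unit[symmetric] unit_mat_mult[symmetric] units_inverse unit_mat_one)
  then have "?m * letter_mat (i, True) * letter_mat (i, False) = letter_mat (i, False)"
    by (simp only: mult_1)
  then show ?thesis
    using letter_mat_cancel[of i True, where ?'a = 'k] by (simp only: mult.assoc not_True_eq_False mult_1_right)
qed

definition word_mat :: "(nat \<times> bool) list \<Rightarrow> 'k::field poly mat2" where
  "word_mat w = prod_list (map letter_mat w)"

lemma word_mat_simps:
  "word_mat [] = 1" "word_mat (l # w) = letter_mat l * word_mat w"
  "word_mat (v @ w) = word_mat v * word_mat w"
  by (simp_all add: word_mat_def)

lemma unit_mat_word_eval: "unit_mat (word_eval gen_unit w) = (word_mat w :: 'k::field poly mat2)"
proof (induction w)
  case Nil
  show ?case by (simp add: word_eval_def word_mat_def unit_mat_one)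
next
  case (Cons l w)
  have "(word_eval gen_unit (l # w) :: 'k F_alg units) = (if snd l then gen_unit (fst l) else inverse (gen_unit (fst l)))
      * word_eval gen_unit w"
    by (simp add: word_eval_def split: prod.split)
  with Cons.IH show ?case
    by (cases l; cases "snd l") (simp_all add: unit_mat_mult word_mat_simps
        unit_mat_gen_unit unit_mat_inverse_gen_unit del: letter_mat.simps)
qed

lemma det2_word_mat: "det2 (word_mat w) = 1"
  by (induction w) (simp_all add: word_mat_simps det2_one det2_mult det2_letter_mat)

text \<open>A letter acts by two shears. The condition says that after the first one the coordinate
  just changed has strictly larger degree than the other.\<close>

fun repelled :: "nat \<times> bool \<Rightarrow> 'k::field poly \<times> 'k poly \<Rightarrow> bool" where
  "repelled (i, True) (x, y) \<longleftrightarrow> degree x < degree (y + shear_poly i * x)"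
| "repelled (i, False) (x, y) \<longleftrightarrow> degree y < degree (x - shear_poly i * y)"

text \<open>The image of the \<open>repelled\<close> region under the letter, described by undoing
  its second shear.\<close>

fun attracted :: "nat \<times> bool \<Rightarrow> 'k::field poly \<times> 'k poly \<Rightarrow> bool" where
  "attracted (i, True) (x, y) \<longleftrightarrow> degree (x - shear_poly i * y) < degree y"
| "attracted (i, False) (x, y) \<longleftrightarrow> degree (y + shear_poly i * x) < degree x"

fun vdegree :: "'k::field poly \<times> 'k poly \<Rightarrow> nat" where
  "vdegree (x, y) = max (degree x) (degree y)"

definition cancels :: "'x \<times> bool \<Rightarrow> 'x \<times> bool \<Rightarrow> bool" where
  "cancels l m \<longleftrightarrow> m = (fst l, \<not> snd l)"

lemma degree_shear_poly: "degree (shear_poly i) = Suc i"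
  by (simp add: shear_poly_def degree_monom_eq)

lemma degree_shear_poly_diff: "i \<noteq> j \<Longrightarrow> 0 < degree (shear_poly i - shear_poly j :: 'k::field poly)"
  using le_degree[of "shear_poly i - shear_poly j :: 'k poly" "Suc i"] by (simp add: shear_poly_def)

text \<open>The strict inequality forces \<open>x\<close> to be nonzero, so the degrees of
  \<open>p\<close> and \<open>x\<close> add up and the product outweighs \<open>z\<close>.\<close>

lemma degree_add_mult_small:
  fixes p x z :: "'k::field poly"
  assumes "degree z < degree x" "p \<noteq> 0"
  shows "degree (z + p * x) = degree p + degree x" and "degree (z - p * x) = degree p + degree x"
proof -
  have *: "degree (p * x) = degree p + degree x"
    using assms by (intro degree_mult_eq) auto
  then show "degree (z + p * x) = degree p + degree x"
    using assms by (subst degree_add_eq_right) auto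
  show "degree (z - p * x) = degree p + degree x"
    using * assms degree_add_eq_right[of z "- (p * x)"] by simp
qed

lemma shear_poly_nonzero: "shear_poly i \<noteq> 0"
  using degree_shear_poly[of i] by (metis degree_0 nat.distinct(1))

text \<open>The second shear adds a non-constant multiple of the dominant coordinate to the other
  one, which lifts its degree above both old degrees.\<close>

lemma repelled_letter_mat:
  assumes "repelled l v"
  shows "attracted l (act2 (letter_mat l) v)" and "vdegree v < vdegree (act2 (letter_mat l) v)"
proof -
  obtain x y where v: "v = (x, y)" by force
  obtain i b where l: "l = (i, b)" by force
  let ?p = "shear_poly i :: 'a poly"
  note deg = degree_shear_poly[of i, where ?'a = 'a]
  show "attracted l (act2 (letter_mat l) v)"
    using assms unfolding v l by (cases b) (simp_all add: algebra_simps)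
  show "vdegree v < vdegree (act2 (letter_mat l) v)"
  proof (cases b)
    case True
    define y' where "y' = y + ?p * x"
    have lt: "degree x < degree y'" using assms by (simp add: v l True y'_def)
    have "act2 (letter_mat l) v = (x + ?p * y', y')"
      by (simp add: v l True y'_def algebra_simps)
    moreover have "degree (x + ?p * y') = Suc i + degree y'"
      using degree_add_mult_small(1)[OF lt shear_poly_nonzero] by (simp add: deg)
    \<comment> \<open>The old coordinate is recovered by undoing the first shear, which bounds its
      degree.\<close>
    moreover have "degree y < Suc i + degree y'"
    proof -
      have "degree (y' - ?p * x) \<le> max (degree y') (Suc i + degree x)"
        using degree_diff_le_max[of y' "?p * x"] degree_mult_le[of ?p x] by (simp add: deg)
      with lt show ?thesis by (simp add: y'_def)
    qed
    ultimately show ?thesis using lt by (simp add: v)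
  next
    case False
    define x' where "x' = x - ?p * y"
    have lt: "degree y < degree x'" using assms by (simp add: v l False x'_def)
    have "act2 (letter_mat l) v = (x', y - ?p * x')"
      by (simp add: v l False x'_def algebra_simps)
    moreover have "degree (y - ?p * x') = Suc i + degree x'"
      using degree_add_mult_small(2)[OF lt shear_poly_nonzero] by (simp add: deg)
    moreover have "degree x < Suc i + degree x'"
    proof -
      have "degree (x' + ?p * y) \<le> max (degree x') (Suc i + degree y)"
        using degree_add_le_max[of x' "?p * y"] degree_mult_le[of ?p y] by (simp add: deg)
      with lt show ?thesis by (simp add: x'_def)
    qed
    ultimately show ?thesis using lt by (simp add: v)
  qed
qed

text \<open>The ping-pong step. With equal signs, the coordinate enlarged by \<open>m\<close> drives
  the first shear of \<open>l\<close>; with opposite signs, the last shear of \<open>m\<close> and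
  the first of \<open>l\<close> have the same direction and merge.\<close>

lemma attracted_imp_repelled:
  assumes "attracted m v" "\<not> cancels l m"
  shows "repelled l v"
proof -
  obtain x y where v: "v = (x, y)" by force
  obtain i b where l: "l = (i, b)" by force
  obtain j c where m: "m = (j, c)" by force
  note deg = degree_shear_poly[where ?'a = 'a]
  note nz = shear_poly_nonzero[where ?'a = 'a]
  show ?thesis
  proof (cases "b = c")
    case True
    show ?thesis
    proof (cases c)
      case c: True
      have lt: "degree (x - shear_poly j * y) < degree y"
        using assms(1) by (simp add: v m c)
      have "degree x = Suc j + degree y"
        using degree_add_mult_small(1)[OF lt nz, of j] by (simp add: deg)
      then have "degree (y + shear_poly i * x) = Suc i + degree x"
        by (subst degree_add_mult_small(1)) (simp_all add: deg nz)
      then show ?thesis by (simp add: v l True c)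
    next
      case c: False
      have lt: "degree (y + shear_poly j * x) < degree x"
        using assms(1) by (simp add: v m c)
      have "degree y = Suc j + degree x"
        using degree_add_mult_small(2)[OF lt nz, of j] by (simp add: deg)
      then have "degree (x - shear_poly i * y) = Suc i + degree y"
        by (subst degree_add_mult_small(2)) (simp_all add: deg nz)
      then show ?thesis by (simp add: v l True c)
    qed
  next
    case False
    \<comment> \<open>With opposite signs only different generators avoid cancellation. The merged
      shear then has a non-constant parameter, which gives the strict inequality.\<close>
    with assms(2) have "i \<noteq> j" by (auto simp: l m cancels_def)
    then have d: "0 < degree (shear_poly i - shear_poly j :: 'a poly)"
      by (rule degree_shear_poly_diff)
    then have d0: "shear_poly i - shear_poly j \<noteq> (0 :: 'a poly)"
      by (metis degree_0 less_irrefl)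
    show ?thesis
    proof (cases c)
      case c: True
      have lt: "degree (x - shear_poly j * y) < degree y"
        using assms(1) by (simp add: v m c)
      have "x - shear_poly i * y = (x - shear_poly j * y) - (shear_poly i - shear_poly j) * y"
        by (simp add: algebra_simps)
      then have "degree (x - shear_poly i * y) = degree (shear_poly i - shear_poly j :: 'a poly) + degree y"
        by (simp only: degree_add_mult_small(2)[OF lt d0])
      then show ?thesis
        using d False by (simp add: v l c)
    next
      case c: False
      have lt: "degree (y + shear_poly j * x) < degree x"
        using assms(1) by (simp add: v m c)
      have "y + shear_poly i * x = (y + shear_poly j * x) + (shear_poly i - shear_poly j) * x"
        by (simp add: algebra_simps)
      then have "degree (y + shear_poly i * x) = degree (shear_poly i - shear_poly j :: 'a poly) + degree x"
        by (simp only: degree_add_mult_small(1)[OF lt d0])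
      then show ?thesis
        using d False by (simp add: v l c)
    qed
  qed
qed

text \<open>One starting vector serves every letter: the first shear turns one coordinate into 1 + p
  or 1 - p with p non-constant.\<close>

lemma repelled_base: "repelled l (1, 1)"
proof -
  have "degree (1 + shear_poly i :: 'a poly) = Suc i" "degree (1 - shear_poly i :: 'a poly) = Suc i" for i
    using degree_add_eq_right[of 1 "shear_poly i :: 'a poly"]
      degree_add_eq_right[of 1 "- shear_poly i :: 'a poly"]
    by (simp_all add: degree_shear_poly)
  then show ?thesis
    by (cases l rule: letter_mat.cases) simp_all
qed

section \<open>Degree growth along reduced words\<close>

abbreviation reduced :: "('x \<times> bool) list \<Rightarrow> bool" where
  "reduced \<equiv> successively (\<lambda>l m. \<not> cancels l m)"

definition word_vec :: "(nat \<times> bool) list \<Rightarrow> 'k::field poly \<times> 'k poly" where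
  "word_vec w = act2 (word_mat w) (1, 1)"

lemma word_vec_simps:
  "word_vec [] = (1, 1)" "word_vec (l # w) = act2 (letter_mat l) (word_vec w)"
  by (simp_all add: word_vec_def word_mat_simps act2_one act2_mult del: act2.simps)

text \<open>Each letter sends the vector into its attracting region, and the next letter to the left
  does not cancel it.\<close>

lemma reduced_repelled:
  assumes "reduced (l # w)"
  shows "repelled l (word_vec w :: 'k::field poly \<times> 'k poly)"
  using assms
proof (induction w arbitrary: l)
  case Nil
  show ?case by (simp add: word_vec_simps repelled_base)
next
  case (Cons m w)
  then have "repelled m (word_vec w :: 'k poly \<times> 'k poly)"
    by simp
  then have "attracted m (word_vec (m # w) :: 'k poly \<times> 'k poly)"
    unfolding word_vec_simps by (rule repelled_letter_mat)
  with Cons.prems show ?case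
    by (auto intro: attracted_imp_repelled)
qed

lemma reduced_append_growth:
  assumes "reduced (v @ w)" "v \<noteq> []"
  shows "vdegree (word_vec w :: 'k::field poly \<times> 'k poly) < vdegree (word_vec (v @ w) :: 'k::field poly \<times> 'k poly)"
  using assms
proof (induction v)
  case Nil
  then show ?case by simp
next
  case (Cons l v)
  have grow: "vdegree (word_vec (v @ w) :: 'k poly \<times> 'k poly) < vdegree (word_vec (l # v @ w) :: 'k poly \<times> 'k poly)"
    unfolding word_vec_simps
    by (rule repelled_letter_mat(2), rule reduced_repelled) (use Cons.prems in simp)
  \<comment> \<open>Only a weak inequality, since \<open>v\<close> may be empty here.\<close>
  have "vdegree (word_vec w :: 'k poly \<times> 'k poly) \<le> vdegree (word_vec (v @ w) :: 'k poly \<times> 'k poly)"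
    using Cons by (cases "v = []") (auto simp: successively_Cons)
  with grow show ?case by simp
qed

text \<open>Reducedness of \<open>w @ w\<close> says that \<open>w\<close> is cyclically reduced.
  The degree must then grow from \<open>w\<close> to \<open>w @ w\<close>, while trace 2 makes the
  second vector twice the first minus (1, 1).\<close>

lemma trace2_cyclically_reduced:
  assumes "reduced (w @ w)" "w \<noteq> []"
  shows "trace2 (word_mat w :: 'k::field poly mat2) \<noteq> 2"
proof
  assume tr: "trace2 (word_mat w :: 'k poly mat2) = 2"
  obtain x y where xy: "word_vec w = (x, y :: 'k poly)" by force
  have "word_vec (w @ w) = (2 * x - 1, 2 * y - 1)"
    using act2_square_unipotent[OF det2_word_mat tr xy[unfolded word_vec_def]]
      xy by (simp add: word_vec_def word_mat_simps act2_mult)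
  \<comment> \<open>An upper bound suffices, so characteristic 2, where 2z vanishes, is no
    exception.\<close>
  moreover have "degree (2 * z - 1) \<le> degree z" for z :: "'k poly"
    unfolding mult_2 by (intro degree_diff_le degree_add_le) simp_all
  then have "degree (2 * x - 1) \<le> degree x" "degree (2 * y - 1) \<le> degree y"
    by blast+
  ultimately show False
    using reduced_append_growth[OF assms, where ?'k = 'k] by (auto simp: xy less_max_iff_disj)
qed

section \<open>Words of trace 2 in the free group\<close>

lemma not_reducedE:
  assumes "\<not> reduced w"
  obtains xs x b ys where "w = xs @ (x, b) # (x, \<not> b) # ys"
proof -
  have "\<exists>xs x b ys. w = xs @ (x, b) # (x, \<not> b) # ys"
    using assms
  proof (induction w)
    case (Cons l w)
    show ?case
    proof (cases "reduced w")
      case True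
      with Cons.prems obtain ys where "w = (fst l, \<not> snd l) # ys"
        by (cases w) (auto simp: cancels_def)
      then have "l # w = [] @ (fst l, snd l) # (fst l, \<not> snd l) # ys"
        by simp
      then show ?thesis by blast
    next
      case False
      with Cons.IH show ?thesis by (metis append_Cons)
    qed
  qed simp
  with that show thesis by blast
qed

lemma abs_free_group_append: "abs_free_group (v @ w) = abs_free_group v + abs_free_group w"
  by (simp add: plus_free_group.abs_eq)

lemma abs_free_group_cancel: "abs_free_group [(x, b), (x, \<not> b)] = 0"
proof -
  have "fg_cancel ([] @ (x, b) # (x, \<not> b) # []) ([] @ [])"
    by (rule fg_cancel.intros)
  then have "equivclp fg_cancel [(x, b), (x, \<not> b)] []"
    by auto
  then show ?thesis
    by (simp add: zero_free_group_def free_group.abs_eq_iff)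
qed

text \<open>Induction on length: deleting a cancelling pair keeps the matrix and the group element,
  and conjugation by a letter keeps the trace and triviality, so a word whose ends cancel can be
  shortened too.\<close>

lemma trace2_eq_2_imp_trivial:
  assumes "trace2 (word_mat w :: 'k::field poly mat2) = 2"
  shows "abs_free_group w = 0"
  using assms
proof (induction "length w" arbitrary: w rule: less_induct)
  case less
  consider "w = []" | "\<not> reduced w" | "w \<noteq> []" "reduced w" "\<not> reduced (w @ w)"
    using trace2_cyclically_reduced less.prems by blast
  then show ?case
  proof cases
    case 1
    then show ?thesis by (simp add: zero_free_group_def)
  next
    case 2
    then obtain xs x b ys where w: "w = xs @ [(x, b), (x, \<not> b)] @ ys"
      by (auto elim: not_reducedE)
    have "word_mat w = (word_mat (xs @ ys) :: 'k poly mat2)"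
      unfolding w by (simp only: word_mat_simps mult_1_right letter_mat_cancel mult_1)
    then have "abs_free_group (xs @ ys) = 0"
      using less.hyps[of "xs @ ys"] less.prems by (simp add: w)
    then show ?thesis
      by (simp only: w abs_free_group_append abs_free_group_cancel add_0)
  next
    case 3
    \<comment> \<open>\<open>w\<close> itself is reduced, so the cancelling pair in
      \<open>w @ w\<close> sits at the seam.\<close>
    then have c: "cancels (last w) (hd w)"
      by (auto simp: successively_append_iff)
    obtain l v where lv: "w = l # v" using 3 by (cases w) auto
    obtain x b where l: "l = (x, \<not> b)" and last: "last w = (x, b)"
      using c by (cases "last w") (auto simp: lv cancels_def)
    \<comment> \<open>In a one-letter word the first and last letters coincide, but here their signs
      are opposite.\<close>
    from l last lv have "v \<noteq> []" by auto
    then obtain v' where "v = v' @ [(x, b)]"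
      using last lv by (metis append_butlast_last_id last_ConsR)
    then have w: "w = [(x, \<not> b)] @ v' @ [(x, b)]" by (simp add: lv l)
    \<comment> \<open>Cyclic invariance of the trace moves the first letter to the end, where it
      cancels against the last.\<close>
    have "trace2 (word_mat w :: 'k poly mat2) = trace2 (word_mat v' * (letter_mat (x, b) * letter_mat (x, \<not> b)))"
      unfolding w
      by (simp only: word_mat_simps mult_1_right trace2_mult_commute[of "letter_mat (x, \<not> b)"] mult.assoc)
    then have "abs_free_group v' = 0"
      using less.hyps[of v'] less.prems
      by (simp only: letter_mat_cancel mult_1_right) (simp add: w)
    moreover have "abs_free_group [(x, \<not> b)] + abs_free_group [(x, b)] = 0"
      using abs_free_group_cancel[of x "\<not> b"] by (simp flip: abs_free_group_append)
    ultimately show ?thesis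
      by (simp add: w abs_free_group_append[of "[(x, \<not> b)]"] abs_free_group_append del: append_Cons)
  qed
qed


section \<open>Short Laurent polynomial identities\<close>

definition fg_mat :: "nat free_group \<Rightarrow> 'k::field poly mat2" where
  "fg_mat g = unit_mat (fg_eval gen_unit g)"

lemma fg_mat_add: "fg_mat (g + h) = fg_mat g * fg_mat h"
  by (simp add: fg_mat_def fg_eval_add unit_mat_mult)

lemma fg_mat_word: "fg_mat g = word_mat (rep_free_group g)"
  by (simp add: fg_mat_def fg_eval_def unit_mat_word_eval)

lemma fg_mat_zero: "fg_mat 0 = 1"
  by (simp add: fg_mat_def zero_free_group_def fg_eval_abs_free_group word_eval_def unit_mat_one)

lemma trace2_fg_mat_eq_2_iff: "trace2 (fg_mat g :: 'k::field poly mat2) = 2 \<longleftrightarrow> g = 0"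
proof
  assume "trace2 (fg_mat g :: 'k poly mat2) = 2"
  then have "abs_free_group (rep_free_group g) = 0"
    unfolding fg_mat_word by (rule trace2_eq_2_imp_trivial)
  then show "g = 0"
    by (simp add: Quotient3_abs_rep[OF Quotient3_free_group])
qed (simp add: fg_mat_zero trace2_one)

text \<open>Equal matrices put \<open>- h + g\<close> in the kernel, which is trivial by the trace
  criterion.\<close>

lemma fg_mat_inj: "fg_mat g = (fg_mat h :: 'k::field poly mat2) \<longleftrightarrow> g = h"
proof
  assume "fg_mat g = (fg_mat h :: 'k poly mat2)"
  then have "fg_mat (- h + g) = (fg_mat (- h + h) :: 'k poly mat2)"
    by (simp only: fg_mat_add)
  then have "trace2 (fg_mat (- h + g) :: 'k poly mat2) = 2"
    by (simp only: left_minus fg_mat_zero trace2_one)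
  then show "g = h"
    using neg_eq_iff_add_eq_0[of "- h" g] by (simp add: trace2_fg_mat_eq_2_iff)
qed simp

section \<open>Determinants and three-term relations\<close>

lemma det2_scalar_add:
  "det2 (Mat2 p 0 0 p + Mat2 q 0 0 q * m) = p * p + p * q * trace2 m + q * q * det2 m"
  by (cases m) (simp add: algebra_simps)

text \<open>The size of the matrices is even, so the sign disappears.\<close>

lemma det2_uminus_scalar_mult: "det2 (- (Mat2 p 0 0 p * m)) = p * p * det2 m"
  by (cases m) (simp add: algebra_simps)

text \<open>The determinants of a + b m and - c n agree. As c = -(a + b), their difference is a b
  (\<open>trace2 m\<close> - 2), and K[t] has no zero divisors.\<close>

lemma trinomial_trace:
  fixes m n :: "'k::field poly mat2"
  assumes "scalar2 a + scalar2 b * m + scalar2 c * n = 0" "a + b + c = 0"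
    and "a \<noteq> 0" "b \<noteq> 0" "det2 m = 1" "det2 n = 1"
  shows "trace2 m = 2"
proof -
  have "scalar2 a + scalar2 b * m = - (scalar2 c * n)"
    using assms(1) by (simp add: eq_neg_iff_add_eq_0)
  then have "det2 (scalar2 a + scalar2 b * m) = det2 (- (scalar2 c * n))"
    by simp
  moreover have "det2 (scalar2 a + scalar2 b * m) =
      [:a:] * [:a:] + [:a:] * [:b:] * trace2 m + [:b:] * [:b:] * det2 m"
    unfolding scalar2_def by (rule det2_scalar_add)
  moreover have "det2 (- (scalar2 c * n)) = [:c:] * [:c:] * det2 n"
    unfolding scalar2_def by (rule det2_uminus_scalar_mult)
  moreover have "c = - (a + b)"
    using assms(2) by (simp only: eq_neg_iff_add_eq_0 add.commute)
  then have "[:c:] = - ([:a:] + [:b:])"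
    by simp
  ultimately have "[:a:] * [:a:] + [:a:] * [:b:] * trace2 m + [:b:] * [:b:]
      - ([:a:] + [:b:]) * ([:a:] + [:b:]) = 0"
    using assms(5,6) by (simp only: mult_1_right minus_mult_minus diff_self)
  moreover have "p * p + p * q * t + q * q - (p + q) * (p + q) = p * q * (t - 2)" for p q t :: "'k poly"
    by (simp add: algebra_simps)
  ultimately have "[:a:] * [:b:] * (trace2 m - 2) = 0"
    by (simp only:)
  then show ?thesis
    using assms(3,4) by simp
qed

text \<open>Every group element evaluates to 1 here, so this substitution computes the augmentation
  of the group algebra.\<close>

lemma laurent_eval_one:
  fixes f :: "'k::field laurent"
  shows "laurent_eval scale_F (\<lambda>_. 1) f = scalar_F (\<Sum>g\<in>Poly_Mapping.keys f. Poly_Mapping.lookup f g)"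
proof -
  have one: "inverse (1 :: 'k F_alg units) = 1"
    by (metis units_inverse(1) mult_1)
  have "word_eval (\<lambda>_. 1) w = (1 :: 'k F_alg units)" for w :: "(nat \<times> bool) list"
    by (induction w) (auto simp: word_eval_def one)
  then have "laurent_eval scale_F (\<lambda>_. 1) f = (\<Sum>g\<in>Poly_Mapping.keys f. scalar_F (Poly_Mapping.lookup f g))"
    by (simp add: laurent_eval_def fg_eval_def one_units.rep_eq scale_F_conv_mult)
  also have "\<dots> = scalar_F (\<Sum>g\<in>Poly_Mapping.keys f. Poly_Mapping.lookup f g)"
  proof -
    have "scalar_F (0 :: 'k) = 0" using scalar_F_add[of "0 :: 'k" 0] by simp
    then have "(\<Sum>g\<in>A. scalar_F (Poly_Mapping.lookup f g)) = scalar_F (\<Sum>g\<in>A. Poly_Mapping.lookup f g)" for A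
      by (induction A rule: infinite_finite_induct) (simp_all add: scalar_F_add)
    then show ?thesis .
  qed
  finally show ?thesis .
qed

theorem proposition1p6:
  fixes f :: "'k::field laurent"
  assumes "laurent_identity (scale_F :: 'k \<Rightarrow> 'k F_alg \<Rightarrow> 'k F_alg) f"
    and "f \<noteq> 0"
  shows "card (Poly_Mapping.keys f) \<ge> 4"
proof (rule ccontr)
  define c where "c = Poly_Mapping.lookup f"
  let ?S = "Poly_Mapping.keys f"
  have eval: "laurent_eval scale_F u f = 0" for u
    using assms(1) by (simp add: laurent_identity_def)
  have nz: "c g \<noteq> 0" if "g \<in> ?S" for g
    using that by (simp add: c_def in_keys_iff)
  have sum0: "(\<Sum>g\<in>?S. c g) = 0"
  proof -
    have "scale_F (\<Sum>g\<in>?S. c g) 1 = 0"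
      using eval[of "\<lambda>_. 1"] by (simp add: laurent_eval_one scale_F_conv_mult c_def)
    then show ?thesis by (simp add: F_alg.scale_eq_0_iff)
  qed
  \<comment> \<open>The ring homomorphism \<open>F_mat\<close> carries the substitution of
    \<open>gen_unit\<close> to a linear relation among matrices.\<close>
  have mat0: "(\<Sum>g\<in>?S. scalar2 (c g) * fg_mat g) = 0"
    using arg_cong[OF eval[of gen_unit], of F_mat]
    by (simp add: laurent_eval_def F_mat_sum F_mat_scale F_mat_zero fg_mat_def unit_mat_def c_def)
  assume "\<not> 4 \<le> card ?S"
  moreover have "card ?S \<noteq> 0"
    using assms(2) by simp
  ultimately consider "card ?S = 1" | "card ?S = 2" | "card ?S = 3"
    by linarith
  then show False
  proof cases
    case 1
    then obtain g where "?S = {g}" by (auto simp: card_1_singleton_iff)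
    with sum0 nz show False by simp
  next
    case 2
    then obtain g h where S: "?S = {g, h}" "g \<noteq> h" by (auto simp: card_2_iff)
    then have "c h = - c g"
      using sum0 by (simp add: eq_neg_iff_add_eq_0 add.commute)
    moreover have "scalar2 (- c g) = - scalar2 (c g)"
      by (simp add: scalar2_def)
    ultimately have "scalar2 (c g) * (fg_mat g - fg_mat h) = 0"
      using mat0 S by (simp add: algebra_simps)
    \<comment> \<open>Matrices have zero divisors, so the coefficient is removed by multiplying with
      its inverse in K.\<close>
    then have "scalar2 (inverse (c g) * c g) * (fg_mat g - fg_mat h) = 0"
      by (simp only: scalar2.s_mult mult.assoc mult_zero_right)
    then have "fg_mat g = (fg_mat h :: 'k poly mat2)"
      using nz[of g] S by (simp add: scalar2.s_one)
    with S show False by (simp add: fg_mat_inj)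
  next
    case 3
    then obtain g h k where S: "?S = {g, h, k}" "g \<noteq> h" "g \<noteq> k" "h \<noteq> k"
      by (auto simp: card_3_iff)
    \<comment> \<open>Dividing on the left by \<open>fg_mat g\<close> makes the first term scalar,
      the shape that \<open>trinomial_trace\<close> expects.\<close>
    have "fg_mat (- g) * (scalar2 (c g) * fg_mat g + scalar2 (c h) * fg_mat h + scalar2 (c k) * fg_mat k) = 0"
      using mat0 S by (simp add: add.assoc)
    moreover have "fg_mat (- g) * (scalar2 a * fg_mat x) = scalar2 a * fg_mat (- g + x)" for a :: 'k and x
      by (metis fg_mat_add mult.assoc scalar2.s_commute)
    ultimately have "scalar2 (c g) + scalar2 (c h) * fg_mat (- g + h) + scalar2 (c k) * fg_mat (- g + k) = 0"
      by (simp add: distrib_left fg_mat_zero)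
    moreover have "c g + c h + c k = 0"
      using sum0 S by (simp add: add.assoc)
    ultimately have "trace2 (fg_mat (- g + h) :: 'k poly mat2) = 2"
      by (rule trinomial_trace) (use nz S in \<open>simp_all add: fg_mat_word det2_word_mat\<close>)
    then show False
      using S neg_eq_iff_add_eq_0[of "- g" h] by (simp add: trace2_fg_mat_eq_2_iff)
  qed
qed

end
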